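(* Let $m\le n$ be positive integers, let $\mathbf{A}\in\mathbb{R}^{m\times n}$, let $\mathbf{R}\in\mathbb{R}^{m\times m}$ be diagonal and symmetric positive definite, let $\mathbf{Q}\in\mathbb{R}^{n\times n}$ be symmetric positive definite, let $\boldsymbol{\mu}\in\mathbb{R}^n$, $\mathbf{d}\in\mathbb{R}^m$, and let $\pi[\bar{\boldsymbol{\theta}}]>0$ be a fixed real number. Put $\mathbf{Z}=\mathbf{A}\mathbf{Q}\mathbf{A}^\top+\mathbf{R}$ and $$\bar{\mathcal{F}}=-\log\pi[\bar{\boldsymbol{\theta}}]+\tfrac12\log\det(\mathbf{Z})+\tfrac12\|\mathbf{A}\boldsymbol{\mu}-\mathbf{d}\|_{\mathbf{Z}^{-1}}^2 .$$ Suppose that $k\ge 1$ iterations of the generalized Golub-Kahan (genGK) bidiagonalization applied to $\mathbf{A},\mathbf{R},\mathbf{Q},\boldsymbol{\mu},\mathbf{d}$ (defined in the context) have been carried out without breakdown, giving $\mathbf{U}_{k+1}$, $\mathbf{V}_k$, $\mathbf{B}_k$ and $\beta_1=\|\mathbf{d}-\mathbf{A}\boldsymbol{\mu}\|_{\mathbf{R}^{-1}}$. Let $\boldsymbol{\Theta}_k=\mathbf{I}_{k+1}+\mathbf{B}_k\mathbf{B}_k^\top$ and $$\tilde{\mathcal{F}}_k=-\log\pi[\bar{\boldsymbol{\theta}}]+\tfrac12\log\det(\mathbf{R})+\tfrac12\log\det(\boldsymbol{\Theta}_k)+\tfrac12\|\beta_1\mathbf{e}_1\|_{\boldsymbol{\Theta}_k^{-1}}^2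 ,$$ where $\mathbf{e}_1$ is the first standard basis vector of $\mathbb{R}^{k+1}$. Define the orthogonal projector $\boldsymbol{\Pi}_{\mathbf{V}_k}=\mathbf{Q}^{1/2}\mathbf{V}_k(\mathbf{Q}^{1/2}\mathbf{V}_k)^\top$, and let $\mathbf{H}_{\mathbf{Q}}=\mathbf{Q}^{1/2}\mathbf{A}^\top\mathbf{R}^{-1}\mathbf{A}\mathbf{Q}^{1/2}$ and $\mathbf{H}_{\mathbf{Q}}^{(k)}=\boldsymbol{\Pi}_{\mathbf{V}_k}\mathbf{H}_{\mathbf{Q}}\boldsymbol{\Pi}_{\mathbf{V}_k}$. Then $$|\bar{\mathcal{F}}-\tilde{\mathcal{F}}_k|\le\frac12\left[\xi_k+\beta_1^2\left(\frac{\xi_k}{1+\xi_k}\right)\right],$$ where $\xi_k=\mathrm{tr}(\mathbf{H}_{\mathbf{Q}})-\mathrm{tr}(\mathbf{H}_{\mathbf{Q}}^{(k)})$.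
   Context: For a symmetric positive definite matrix $\mathbf{M}$, $\|\mathbf{x}\|_{\mathbf{M}}=\sqrt{\mathbf{x}^\top\mathbf{M}\mathbf{x}}$, and $\mathbf{M}^{1/2}$ is its symmetric positive definite square root. Here $\bar{\boldsymbol{\theta}}$ is a fixed vector of hyperparameters at which all quantities are evaluated, and $\pi[\bar{\boldsymbol{\theta}}]$ is the value of the prior density there. Generalized Golub-Kahan bidiagonalization (exact arithmetic). Initialize by $\beta_1\mathbf{u}_1=\mathbf{d}-\mathbf{A}\boldsymbol{\mu}$ and $\alpha_1\mathbf{v}_1=\mathbf{A}^\top\mathbf{R}^{-1}\mathbf{u}_1$, and for $j=1,\dots,k$ set $$\beta_{j+1}\mathbf{u}_{j+1}=\mathbf{A}\mathbf{Q}\mathbf{v}_j-\alpha_j\mathbf{u}_j,\qquad \alpha_{j+1}\mathbf{v}_{j+1}=\mathbf{A}^\top\mathbf{R}^{-1}\mathbf{u}_{j+1}-\beta_{j+1}\mathbf{v}_j,$$ where the nonnegative scalars $\alpha_i,\beta_i$ are chosen so that $\|\mathbf{u}_i\|_{\mathbf{R}^{-1}}=\|\mathbf{v}_i\|_{\mathbf{Q}}=1$. "Without breakdown" means that all the scalars $\alpha_i,\beta_i$ computed are nonzero, so that the normalized vectors are well defined. Put $\mathbf{U}_{k+1}=[\mathbf{u}_1|\cdots|\mathbf{u}_{k+1}]\in\mathbb{R}^{m\times(k+1)}$, $\mathbf{V}_k=[\mathbf{v}_1|\cdots|\mathbf{v}_k]\in\mathbb{R}^{n\times k}$, and let $\mathbf{B}_k\in\mathbb{R}^{(k+1)\times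 k}$ be the lower bidiagonal matrix with $(\mathbf{B}_k)_{j,j}=\alpha_j$, $(\mathbf{B}_k)_{j+1,j}=\beta_{j+1}$ for $1\le j\le k$ and all other entries zero. These matrices satisfy the orthogonality relations $\mathbf{U}_{k+1}^\top\mathbf{R}^{-1}\mathbf{U}_{k+1}=\mathbf{I}_{k+1}$, $\mathbf{V}_k^\top\mathbf{Q}\mathbf{V}_k=\mathbf{I}_k$, and the relations $\mathbf{U}_{k+1}\beta_1\mathbf{e}_1=\mathbf{d}-\mathbf{A}\boldsymbol{\mu}$, $\mathbf{A}\mathbf{Q}\mathbf{V}_k=\mathbf{U}_{k+1}\mathbf{B}_k$, $\mathbf{A}^\top\mathbf{R}^{-1}\mathbf{U}_{k+1}=\mathbf{V}_k\mathbf{B}_k^\top+\alpha_{k+1}\mathbf{v}_{k+1}\mathbf{e}_{k+1}^\top$. *)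

theory Defs
  imports
    Complex_Main
    "Jordan_Normal_Form.Determinant"
    "Jordan_Normal_Form.Gauss_Jordan_Elimination"
begin

definition spd_mat :: "nat \<Rightarrow> real mat \<Rightarrow> bool" where
  "spd_mat n M \<longleftrightarrow> M \<in> carrier_mat n n \<and> M\<^sup>T = M \<and>
     (\<forall>x \<in> carrier_vec n. x \<noteq> 0\<^sub>v n \<longrightarrow> x \<bullet> (M *\<^sub>v x) > 0)"

definition is_spd_sqrt :: "nat \<Rightarrow> real mat \<Rightarrow> real mat \<Rightarrow> bool" where
  "is_spd_sqrt n M S \<longleftrightarrow> spd_mat n S \<and> S * S = M"

(* Unspecified when M is singular; only applied to symmetric positive definite matrices. *)
definition mat_inv :: "real mat \<Rightarrow> real mat" where
  "mat_inv M = the (mat_inverse M)"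

definition mat_norm :: "real mat \<Rightarrow> real vec \<Rightarrow> real" where
  "mat_norm M x = sqrt (x \<bullet> (M *\<^sub>v x))"

definition mat_trace :: "real mat \<Rightarrow> real" where
  "mat_trace M = (\<Sum>i<dim_row M. M $$ (i, i))"

(* k steps of the generalized Golub-Kahan process without breakdown.  The sequences are
   indexed from 1, and only their values at 1, ..., k + 1 matter.  Positivity of
   alpha i and beta i combines their nonnegativity with the absence of breakdown. *)
definition genGK ::
  "nat \<Rightarrow> nat \<Rightarrow> real mat \<Rightarrow> real mat \<Rightarrow> real mat \<Rightarrow> real vec \<Rightarrow> real vec \<Rightarrow> nat \<Rightarrow>
   (nat \<Rightarrow> real) \<Rightarrow> (nat \<Rightarrow> real) \<Rightarrow> (nat \<Rightarrow> real vec) \<Rightarrow> (nat \<Rightarrow> real vec) \<Rightarrow> bool" where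
  "genGK m n A R Q \<mu> d k \<alpha> \<beta> u v \<longleftrightarrow>
     (\<forall>i \<in> {1..k+1}. u i \<in> carrier_vec m \<and> v i \<in> carrier_vec n \<and>
        mat_norm (mat_inv R) (u i) = 1 \<and> mat_norm Q (v i) = 1 \<and> \<alpha> i > 0 \<and> \<beta> i > 0) \<and>
     \<beta> 1 \<cdot>\<^sub>v u 1 = d - A *\<^sub>v \<mu> \<and>
     \<alpha> 1 \<cdot>\<^sub>v v 1 = A\<^sup>T *\<^sub>v (mat_inv R *\<^sub>v u 1) \<and>
     (\<forall>j \<in> {1..k}.
        \<beta> (j+1) \<cdot>\<^sub>v u (j+1) = A *\<^sub>v (Q *\<^sub>v v j) - \<alpha> j \<cdot>\<^sub>v u j \<and>
        \<alpha> (j+1) \<cdot>\<^sub>v v (j+1) = A\<^sup>T *\<^sub>v (mat_inv R *\<^sub>v u (j+1)) - \<beta> (j+1) \<cdot>\<^sub>v v j)"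

(* Matrix indices start at 0 and scalars at 1: the 0-based entry (j, j) is alpha (j + 1)
   and the 0-based entry (j + 1, j) is beta (j + 2). *)
definition bidiag_mat :: "nat \<Rightarrow> (nat \<Rightarrow> real) \<Rightarrow> (nat \<Rightarrow> real) \<Rightarrow> real mat" where
  "bidiag_mat k \<alpha> \<beta> = mat (k+1) k (\<lambda>(i, j).
     if i = j then \<alpha> (j+1) else if i = j+1 then \<beta> (j+2) else 0)"

end

theory Submission
  imports Defs
begin

text \<open>
  Write \<open>W\<close> for the inverse of \<open>R\<close>.  By a simultaneous induction along the recurrences, the
  \<open>u i\<close> are orthonormal for \<open>W\<close> and the \<open>v i\<close> for \<open>Q\<close> (\<open>genGK_orthonormal\<close>), and
  \<open>A * Q * V = U * B\<close> (\<open>genGK_bidiag\<close>).  The approximate objective is therefore the exact one with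
  \<open>Z\<close> replaced by \<open>M = R + (U * B) * (U * B)\<^sup>T\<close>: Sylvester's determinant identity gives
  \<open>det M = det R * det \<Theta>\<close> (\<open>det_reduced\<close>), and for \<open>e\<close> equal to \<open>\<beta> 1\<close> times the first
  unit vector, so that \<open>U e = d - A \<mu>\<close>, the system \<open>M x = U e\<close> is solved by \<open>x = W U y\<close>
  where \<open>\<Theta> y = e\<close>, and hence the two misfit terms agree (\<open>quad_form_inv_reduced\<close>).

  The two matrices differ by a positive semidefinite term \<open>Z = M + F * F\<^sup>T\<close> with
  \<open>F = A * Qhalf * (1 - \<Pi>V)\<close>, because \<open>1 - \<Pi>V\<close> is an orthogonal projector
  (\<open>gram_projector_split\<close>), and \<open>\<xi> = tr (F\<^sup>T * W * F)\<close> (\<open>trace_projector_split\<close>).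
  It remains to compare the two terms of the objective at \<open>M\<close> and at \<open>Z\<close>.

  Determinants: adding the columns \<open>f\<close> of \<open>F\<close> one at a time multiplies the determinant
  by \<open>1 + f \<bullet> (N\<^sup>-\<^sup>1 f)\<close>, where \<open>N\<close> is the matrix built so far.  As \<open>N\<close>
  dominates \<open>R\<close>, this factor lies between \<open>1\<close> and \<open>exp (f \<bullet> (W f))\<close>; multiplying over all columns
  gives \<open>0 \<le> ln det Z - ln det M \<le> \<xi>\<close> (\<open>det_add_gram_bounds\<close>).

  Quadratic forms: the Cauchy-Schwarz inequality gives \<open>F * F\<^sup>T \<le> \<xi> R \<le> \<xi> M\<close> in the semidefinite order,
  hence \<open>R \<le> M \<le> Z \<le> (1 + \<xi>) M\<close>.  Inversion reverses this order (\<open>quad_form_inv_antimono\<close>),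
  so with \<open>q\<close> the quadratic form of the inverse at the residual one has
  \<open>q\<^sub>Z \<le> q\<^sub>M \<le> (1 + \<xi>) q\<^sub>Z\<close> and \<open>q\<^sub>M \<le> q\<^sub>R = (\<beta> 1)\<^sup>2\<close>,
  and \<open>0 \<le> q\<^sub>M - q\<^sub>Z \<le> (\<beta> 1)\<^sup>2 * \<xi> / (1 + \<xi>)\<close>.
  The two differences enter with opposite signs; the bound adds their maxima.
\<close>

section \<open>Symmetric positive definite matrices and their inverses\<close>

lemma spd_matD:
  assumes "spd_mat n M"
  shows "M \<in> carrier_mat n n" "M\<^sup>T = M"
    "\<And>x. x \<in> carrier_vec n \<Longrightarrow> x \<noteq> 0\<^sub>v n \<Longrightarrow> x \<bullet> (M *\<^sub>v x) > 0"
    "\<And>x. x \<in> carrier_vec n \<Longrightarrow> x \<bullet> (M *\<^sub>v x) \<ge> 0"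
proof -
  show c: "M \<in> carrier_mat n n" and "M\<^sup>T = M"
    and p: "\<And>x. x \<in> carrier_vec n \<Longrightarrow> x \<noteq> 0\<^sub>v n \<Longrightarrow> x \<bullet> (M *\<^sub>v x) > 0"
    using assms unfolding spd_mat_def by auto
  show "x \<bullet> (M *\<^sub>v x) \<ge> 0" if "x \<in> carrier_vec n" for x
    using p[OF that] c that by (cases "x = 0\<^sub>v n") (auto intro: less_imp_le)
qed

lemma symmetric_bilinear:
  fixes M :: "real mat"
  assumes "M \<in> carrier_mat n n" "M\<^sup>T = M" "x \<in> carrier_vec n" "y \<in> carrier_vec n"
  shows "x \<bullet> (M *\<^sub>v y) = y \<bullet> (M *\<^sub>v x)"
proof -
  have "x \<bullet> (M *\<^sub>v y) = (M\<^sup>T *\<^sub>v x) \<bullet> y"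
    using transpose_vec_mult_scalar[of M n n y x] assms by auto
  also have "\<dots> = y \<bullet> (M *\<^sub>v x)"
    using assms by (simp add: comm_scalar_prod[of _ n])
  finally show ?thesis .
qed

lemma mat_inv_props:
  assumes M: "M \<in> carrier_mat n n" and d: "det M \<noteq> 0"
  shows "mat_inv M \<in> carrier_mat n n" "M * mat_inv M = 1\<^sub>m n" "mat_inv M * M = 1\<^sub>m n"
proof -
  have "M \<in> Units (ring_mat TYPE(real) n ())" by (rule det_non_zero_imp_unit[OF M d])
  with mat_inverse(1)[OF M, of "()"] obtain B where B: "mat_inverse M = Some B"
    by (cases "mat_inverse M") auto
  from mat_inverse(2)[OF M B] B show "mat_inv M \<in> carrier_mat n n" "M * mat_inv M = 1\<^sub>m n"
    "mat_inv M * M = 1\<^sub>m n" by (auto simp: mat_inv_def)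
qed

lemma spd_mat_det_nonzero:
  assumes "spd_mat n M"
  shows "det M \<noteq> 0"
proof
  assume "det M = 0"
  with det_0_iff_vec_prod_zero_field[OF spd_matD(1)[OF assms]] obtain x where
    "x \<in> carrier_vec n" "x \<noteq> 0\<^sub>v n" "M *\<^sub>v x = 0\<^sub>v n" by auto
  with spd_matD(3)[OF assms, of x] show False by auto
qed

lemma spd_mat_inv:
  assumes "spd_mat n M"
  shows "mat_inv M \<in> carrier_mat n n" "M * mat_inv M = 1\<^sub>m n" "mat_inv M * M = 1\<^sub>m n"
  using mat_inv_props[OF spd_matD(1)[OF assms] spd_mat_det_nonzero[OF assms]] by auto

lemma spd_mat_inv_mult_vec:
  assumes "spd_mat n M" "x \<in> carrier_vec n"
  shows "mat_inv M *\<^sub>v x \<in> carrier_vec n" "M *\<^sub>v (mat_inv M *\<^sub>v x) = x" "mat_inv M *\<^sub>v (M *\<^sub>v x) = x"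
  using spd_mat_inv[OF assms(1)] spd_matD(1)[OF assms(1)] assms(2)
  by (auto simp flip: assoc_mult_mat_vec)

lemma spd_mat_inv_spd:
  assumes M: "spd_mat n M"
  shows "spd_mat n (mat_inv M)"
proof -
  note I = spd_mat_inv[OF M] and MC = spd_matD(1)[OF M]
  have "(mat_inv M)\<^sup>T * M = (M * mat_inv M)\<^sup>T"
    using transpose_mult[OF MC I(1)] spd_matD(2)[OF M] by simp
  hence "(mat_inv M)\<^sup>T * M * mat_inv M = mat_inv M" using I by auto
  moreover have "(mat_inv M)\<^sup>T * M * mat_inv M = (mat_inv M)\<^sup>T"
    using I MC by (simp add: assoc_mult_mat[of _ n n _ n _ n])
  ultimately have "(mat_inv M)\<^sup>T = mat_inv M" by simp
  moreover have "x \<bullet> (mat_inv M *\<^sub>v x) > 0" if x: "x \<in> carrier_vec n" "x \<noteq> 0\<^sub>v n" for x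
  proof -
    note y = spd_mat_inv_mult_vec[OF M x(1)]
    have "M *\<^sub>v 0\<^sub>v n = 0\<^sub>v n" using MC by (intro eq_vecI) auto
    hence "mat_inv M *\<^sub>v x \<noteq> 0\<^sub>v n" using y x by auto
    from spd_matD(3)[OF M y(1) this] show ?thesis
      using y x by (simp add: comm_scalar_prod[of _ n])
  qed
  ultimately show ?thesis using I unfolding spd_mat_def by auto
qed

lemma mat_norm_power2:
  assumes "spd_mat n M" "x \<in> carrier_vec n"
  shows "(mat_norm M x)\<^sup>2 = x \<bullet> (M *\<^sub>v x)"
  using spd_matD(4)[OF assms] by (simp add: mat_norm_def)

text \<open>The variational characterisation of the inverse: the concave function
  \<open>2 (r \<bullet> x) - x \<bullet> (M x)\<close> attains its maximum at \<open>x = M\<^sup>-\<^sup>1 r\<close>.\<close>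
lemma quad_form_inv_ge:
  assumes M: "spd_mat n M" and r: "r \<in> carrier_vec n" and x: "x \<in> carrier_vec n"
  shows "2 * (r \<bullet> x) - x \<bullet> (M *\<^sub>v x) \<le> r \<bullet> (mat_inv M *\<^sub>v r)"
proof -
  note y = spd_mat_inv_mult_vec[OF M r] and MC = spd_matD(1)[OF M]
  let ?y = "mat_inv M *\<^sub>v r"
  have "0 \<le> (x - ?y) \<bullet> (M *\<^sub>v (x - ?y))"
    using spd_matD(4)[OF M, of "x - ?y"] x y by auto
  also have "M *\<^sub>v (x - ?y) = M *\<^sub>v x - r"
    using x y MC by (simp add: mult_minus_distrib_mat_vec[of _ n n])
  also have "(x - ?y) \<bullet> (M *\<^sub>v x - r) = x \<bullet> (M *\<^sub>v x) - x \<bullet> r - (?y \<bullet> (M *\<^sub>v x) - ?y \<bullet> r)"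
    using x y(1) r MC by (simp add: minus_scalar_prod_distrib[of _ n] scalar_prod_minus_distrib[of _ n])
  also have "?y \<bullet> (M *\<^sub>v x) = x \<bullet> r"
    using symmetric_bilinear[OF MC spd_matD(2)[OF M] y(1) x] y by simp
  also have "x \<bullet> r = r \<bullet> x" using x r by (simp add: comm_scalar_prod[of _ n])
  also have "?y \<bullet> r = r \<bullet> ?y" using y(1) r by (simp add: comm_scalar_prod[of _ n])
  finally show ?thesis by simp
qed

text \<open>If \<open>N \<le> c M\<close> in the semidefinite order, then \<open>M\<^sup>-\<^sup>1 \<le> c N\<^sup>-\<^sup>1\<close>.  Test the variational
  characterisation of \<open>N\<^sup>-\<^sup>1\<close> with the maximiser for \<open>M\<close> scaled by \<open>1 / c\<close>.\<close>
lemma quad_form_inv_antimono: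
  assumes M: "spd_mat n M" and N: "spd_mat n N" and r: "r \<in> carrier_vec n" and c: "c > 0"
    and le: "\<And>x. x \<in> carrier_vec n \<Longrightarrow> x \<bullet> (N *\<^sub>v x) \<le> c * (x \<bullet> (M *\<^sub>v x))"
  shows "r \<bullet> (mat_inv M *\<^sub>v r) \<le> c * (r \<bullet> (mat_inv N *\<^sub>v r))"
proof -
  note y = spd_mat_inv_mult_vec[OF M r]
  let ?y = "mat_inv M *\<^sub>v r" and ?q = "r \<bullet> (mat_inv M *\<^sub>v r)"
  have NC: "N \<in> carrier_mat n n" by (rule spd_matD(1)[OF N])
  have "2 * (r \<bullet> ((1/c) \<cdot>\<^sub>v ?y)) - ((1/c) \<cdot>\<^sub>v ?y) \<bullet> (N *\<^sub>v ((1/c) \<cdot>\<^sub>v ?y)) \<le> r \<bullet> (mat_inv N *\<^sub>v r)"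
    using y by (intro quad_form_inv_ge[OF N r]) auto
  also have "N *\<^sub>v ((1/c) \<cdot>\<^sub>v ?y) = (1/c) \<cdot>\<^sub>v (N *\<^sub>v ?y)"
    using y NC by (simp add: mult_mat_vec[of _ n n])
  also have "2 * (r \<bullet> ((1/c) \<cdot>\<^sub>v ?y)) - ((1/c) \<cdot>\<^sub>v ?y) \<bullet> ((1/c) \<cdot>\<^sub>v (N *\<^sub>v ?y))
      = 2 * ?q / c - ?y \<bullet> (N *\<^sub>v ?y) / c\<^sup>2"
    using y(1) r NC by (simp add: power2_eq_square)
  finally have 1: "2 * ?q / c - ?y \<bullet> (N *\<^sub>v ?y) / c\<^sup>2 \<le> r \<bullet> (mat_inv N *\<^sub>v r)" .
  have "?y \<bullet> (M *\<^sub>v ?y) = ?q" using y r by (simp add: comm_scalar_prod[of _ n])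
  hence "?y \<bullet> (N *\<^sub>v ?y) \<le> c * ?q" using le[OF y(1)] by simp
  hence "?y \<bullet> (N *\<^sub>v ?y) / c\<^sup>2 \<le> ?q / c" using c by (simp add: field_simps power2_eq_square)
  with 1 have "?q / c \<le> r \<bullet> (mat_inv N *\<^sub>v r)" by simp
  thus ?thesis using c by (simp add: field_simps)
qed

text \<open>The Cauchy-Schwarz inequality for the dual norms given by \<open>M\<close> and its inverse.\<close>
lemma scalar_prod_power2_le:
  assumes M: "spd_mat n M" and f: "f \<in> carrier_vec n" and x: "x \<in> carrier_vec n"
  shows "(f \<bullet> x)\<^sup>2 \<le> (f \<bullet> (mat_inv M *\<^sub>v f)) * (x \<bullet> (M *\<^sub>v x))"
proof (cases "x = 0\<^sub>v n")
  case True
  thus ?thesis using f x spd_matD(1)[OF M] by auto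
next
  case False
  define s where "s = x \<bullet> (M *\<^sub>v x)"
  have s: "s > 0" unfolding s_def by (rule spd_matD(3)[OF M x False])
  \<comment> \<open>The multiple of \<open>x\<close> that maximises the lower bound.\<close>
  define t where "t = (f \<bullet> x) / s"
  have MC: "M \<in> carrier_mat n n" by (rule spd_matD(1)[OF M])
  have "2 * (f \<bullet> (t \<cdot>\<^sub>v x)) - (t \<cdot>\<^sub>v x) \<bullet> (M *\<^sub>v (t \<cdot>\<^sub>v x)) \<le> f \<bullet> (mat_inv M *\<^sub>v f)"
    using x by (intro quad_form_inv_ge[OF M f]) auto
  also have "M *\<^sub>v (t \<cdot>\<^sub>v x) = t \<cdot>\<^sub>v (M *\<^sub>v x)"
    using x MC by (simp add: mult_mat_vec[of _ n n])
  also have "2 * (f \<bullet> (t \<cdot>\<^sub>v x)) - (t \<cdot>\<^sub>v x) \<bullet> (t \<cdot>\<^sub>v (M *\<^sub>v x)) = 2 * t * (f \<bullet> x) - t\<^sup>2 * s"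
    using f x MC by (simp add: power2_eq_square s_def)
  also have "\<dots> = (f \<bullet> x)\<^sup>2 / s" using s by (simp add: t_def power2_eq_square field_simps)
  finally show ?thesis using s by (simp add: s_def field_simps)
qed

section \<open>Gram matrices and traces\<close>

lemma gram_index:
  fixes F W :: "real mat"
  assumes F: "F \<in> carrier_mat n p" and W: "W \<in> carrier_mat n n" and ij: "i < p" "j < p"
  shows "(F\<^sup>T * W * F) $$ (i, j) = col F i \<bullet> (W *\<^sub>v col F j)"
proof -
  have "F\<^sup>T * W * F = F\<^sup>T * (W * F)" using F W by (simp add: assoc_mult_mat[of _ p n _ n _ p])
  thus ?thesis using ij F W by (simp add: col_mult2[of W n n F p] mult_mat_vec_def)
qed

lemma mat_trace_gram:
  assumes F: "F \<in> carrier_mat n p" and W: "W \<in> carrier_mat n n"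
  shows "mat_trace (F\<^sup>T * W * F) = (\<Sum>i<p. col F i \<bullet> (W *\<^sub>v col F i))"
  using F by (simp add: mat_trace_def gram_index[OF F W] del: assoc_mult_mat index_mult_mat(1))

lemma mat_trace_comm:
  assumes A: "A \<in> carrier_mat n p" and B: "B \<in> carrier_mat p n"
  shows "mat_trace (A * B) = mat_trace (B * A)"
proof -
  have "mat_trace (A * B) = (\<Sum>i<n. \<Sum>j<p. A $$ (i, j) * B $$ (j, i))"
    using A B by (auto simp: mat_trace_def scalar_prod_def atLeast0LessThan intro!: sum.cong)
  also have "\<dots> = (\<Sum>j<p. \<Sum>i<n. B $$ (j, i) * A $$ (i, j))"
    by (subst sum.swap) (simp add: mult.commute)
  also have "\<dots> = mat_trace (B * A)"
    using A B by (auto simp: mat_trace_def scalar_prod_def atLeast0LessThan intro!: sum.cong)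
  finally show ?thesis .
qed

lemma mat_trace_minus:
  assumes "A \<in> carrier_mat n n" "B \<in> carrier_mat n n"
  shows "mat_trace (A - B) = mat_trace A - mat_trace B"
  using assms by (auto simp: mat_trace_def sum_subtractf)

lemma quad_form_gram:
  fixes F :: "real mat"
  assumes F: "F \<in> carrier_mat n p" and x: "x \<in> carrier_vec n"
  shows "x \<bullet> ((F * F\<^sup>T) *\<^sub>v x) = (\<Sum>i<p. (col F i \<bullet> x)\<^sup>2)"
proof -
  have "x \<bullet> ((F * F\<^sup>T) *\<^sub>v x) = x \<bullet> (F *\<^sub>v (F\<^sup>T *\<^sub>v x))"
    using F x by (simp add: assoc_mult_mat_vec[of F n p "F\<^sup>T" n])
  also have "\<dots> = (F\<^sup>T *\<^sub>v x) \<bullet> (F\<^sup>T *\<^sub>v x)"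
    using F x transpose_vec_mult_scalar[of F n p "F\<^sup>T *\<^sub>v x" x] by auto
  also have "\<dots> = (\<Sum>i<p. (col F i \<bullet> x)\<^sup>2)"
    using F x by (auto simp: scalar_prod_def[of "F\<^sup>T *\<^sub>v x"] power2_eq_square atLeast0LessThan intro!: sum.cong)
  finally show ?thesis .
qed

lemma quad_form_add_gram:
  fixes M F :: "real mat"
  assumes M: "M \<in> carrier_mat n n" and F: "F \<in> carrier_mat n p" and x: "x \<in> carrier_vec n"
  shows "x \<bullet> ((M + F * F\<^sup>T) *\<^sub>v x) = x \<bullet> (M *\<^sub>v x) + (\<Sum>i<p. (col F i \<bullet> x)\<^sup>2)"
proof -
  have FF: "F * F\<^sup>T \<in> carrier_mat n n" using F by simp
  show ?thesis
    using M FF x by (simp add: add_mult_distrib_mat_vec[of _ n n] scalar_prod_add_distrib[of _ n]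
      quad_form_gram[OF F x, symmetric])
qed

lemma spd_mat_add_gram:
  assumes M: "spd_mat n M" and F: "F \<in> carrier_mat n p"
  shows "spd_mat n (M + F * F\<^sup>T)"
proof -
  have MC: "M \<in> carrier_mat n n" by (rule spd_matD(1)[OF M])
  have "(F * F\<^sup>T)\<^sup>T = F * F\<^sup>T" using transpose_mult[of F n p "F\<^sup>T" n] F by simp
  hence "(M + F * F\<^sup>T)\<^sup>T = M + F * F\<^sup>T"
    using transpose_add[of M n n "F * F\<^sup>T"] MC F spd_matD(2)[OF M] by simp
  moreover have "x \<bullet> ((M + F * F\<^sup>T) *\<^sub>v x) > 0" if "x \<in> carrier_vec n" "x \<noteq> 0\<^sub>v n" for x
    using spd_matD(3)[OF M that] quad_form_add_gram[OF MC F that(1)]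
    by (simp add: add_pos_nonneg sum_nonneg)
  ultimately show ?thesis using MC F unfolding spd_mat_def by auto
qed

lemma spd_mat_one: "spd_mat n (1\<^sub>m n)"
proof -
  have "x \<bullet> x > 0" if "x \<in> carrier_vec n" "x \<noteq> 0\<^sub>v n" for x :: "real vec"
  proof -
    from that obtain i where i: "i < n" "x $ i \<noteq> 0" by (auto simp: vec_eq_iff)
    have "0 < (\<Sum>i<n. x $ i * x $ i)"
      using i by (intro sum_pos2[of _ i]) (auto simp: zero_less_mult_iff linorder_neq_iff)
    thus ?thesis using that by (simp add: scalar_prod_def atLeast0LessThan)
  qed
  thus ?thesis unfolding spd_mat_def by auto
qed

text \<open>In the semidefinite order, \<open>F * F\<^sup>T \<le> tr (F\<^sup>T * R\<^sup>-\<^sup>1 * F) R\<close>.\<close>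
lemma quad_form_gram_le_trace:
  assumes R: "spd_mat n R" and F: "F \<in> carrier_mat n p" and x: "x \<in> carrier_vec n"
  shows "(\<Sum>i<p. (col F i \<bullet> x)\<^sup>2) \<le> mat_trace (F\<^sup>T * mat_inv R * F) * (x \<bullet> (R *\<^sub>v x))"
proof -
  have "(\<Sum>i<p. (col F i \<bullet> x)\<^sup>2) \<le> (\<Sum>i<p. (col F i \<bullet> (mat_inv R *\<^sub>v col F i)) * (x \<bullet> (R *\<^sub>v x)))"
    using F x by (intro sum_mono scalar_prod_power2_le[OF R]) auto
  thus ?thesis by (simp add: mat_trace_gram[OF F spd_mat_inv(1)[OF R]] sum_distrib_right)
qed

section \<open>Determinants of Gram updates\<close>

text \<open>Sylvester's determinant identity.  The block matrix with rows \<open>(1, -A)\<close> and \<open>(B, 1)\<close> is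
  factored in two ways into block triangular matrices.\<close>
lemma det_one_plus_mult_commute:
  fixes A B :: "'a :: idom mat"
  assumes A: "A \<in> carrier_mat n k" and B: "B \<in> carrier_mat k n"
  shows "det (1\<^sub>m n + A * B) = det (1\<^sub>m k + B * A)"
proof -
  let ?L = "four_block_mat (1\<^sub>m n) (0\<^sub>m n k) B (1\<^sub>m k)"
  let ?P = "four_block_mat (1\<^sub>m n) (- A) (0\<^sub>m k n) (1\<^sub>m k + B * A)"
  let ?S = "four_block_mat (1\<^sub>m n + A * B) (- A) (0\<^sub>m k n) (1\<^sub>m k)"
  have eq1: "?L * ?P = four_block_mat (1\<^sub>m n) (- A) B (1\<^sub>m k)"
    using A B by (subst mult_four_block_mat[where ?n1.0=n and ?n2.0=k and ?nr1.0=n and ?nr2.0=k and ?nc1.0=n and ?nc2.0=k])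
      (auto intro!: cong_four_block_mat)
  have eq2: "?S * ?L = four_block_mat (1\<^sub>m n) (- A) B (1\<^sub>m k)"
    using A B by (subst mult_four_block_mat[where ?n1.0=n and ?n2.0=k and ?nr1.0=n and ?nr2.0=k and ?nc1.0=n and ?nc2.0=k])
      (auto intro!: cong_four_block_mat eq_matI)
  have c: "?L \<in> carrier_mat (n + k) (n + k)" "?P \<in> carrier_mat (n + k) (n + k)"
    "?S \<in> carrier_mat (n + k) (n + k)" using A B by auto
  have dL: "det ?L = 1" using A B
    by (subst det_four_block_mat_upper_right_zero[where n=n and m=k]) auto
  have dP: "det ?P = det (1\<^sub>m k + B * A)" using A B
    by (subst det_four_block_mat_lower_left_zero[where n=n and m=k]) auto
  have dS: "det ?S = det (1\<^sub>m n + A * B)" using A B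
    by (subst det_four_block_mat_lower_left_zero[where n=n and m=k]) auto
  from arg_cong[OF trans[OF eq1 eq2[symmetric]], of det] show ?thesis
    by (simp add: det_mult[OF c(1,2)] det_mult[OF c(3,1)] dL dP dS)
qed

lemma det_add_mult:
  fixes F G :: "real mat"
  assumes M: "M \<in> carrier_mat n n" and d: "det M \<noteq> 0"
    and F: "F \<in> carrier_mat n p" and G: "G \<in> carrier_mat p n"
  shows "det (M + F * G) = det M * det (1\<^sub>m p + G * mat_inv M * F)"
proof -
  note I = mat_inv_props[OF M d]
  have "M * (mat_inv M * F * G) = (M * mat_inv M) * (F * G)"
    using M F G I(1) by (simp add: assoc_mult_mat[of _ n n _ n _ n] assoc_mult_mat[of _ n n _ p _ n])
  hence "M + F * G = M * (1\<^sub>m n + mat_inv M * F * G)"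
    using M F G I by (simp add: mult_add_distrib_mat[of _ n n _ n])
  hence "det (M + F * G) = det M * det (1\<^sub>m n + (mat_inv M * F) * G)"
    using M F G I(1) by (simp add: det_mult[of _ n])
  also have "det (1\<^sub>m n + (mat_inv M * F) * G) = det (1\<^sub>m p + G * (mat_inv M * F))"
    using F G I(1) by (intro det_one_plus_mult_commute) auto
  finally show ?thesis using F G I(1) by (simp add: assoc_mult_mat[of _ p n _ n _ p])
qed

text \<open>The matrix determinant lemma for a symmetric rank-one update.\<close>
lemma det_add_rank_one:
  assumes M: "spd_mat n M" and f: "f \<in> carrier_vec n"
  shows "det (M + mat n n (\<lambda>(a, b). f $ a * f $ b)) = det M * (1 + f \<bullet> (mat_inv M *\<^sub>v f))"
proof -
  let ?F = "mat n 1 (\<lambda>(a, b). f $ a)"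
  have MC: "M \<in> carrier_mat n n" by (rule spd_matD(1)[OF M])
  have I: "mat_inv M \<in> carrier_mat n n" by (rule spd_mat_inv(1)[OF M])
  have F: "?F \<in> carrier_mat n 1" by simp
  have FF: "mat n n (\<lambda>(a, b). f $ a * f $ b) = ?F * ?F\<^sup>T"
    by (rule eq_matI) (auto simp: scalar_prod_def)
  have "mat_trace (?F\<^sup>T * mat_inv M * ?F) = f \<bullet> (mat_inv M *\<^sub>v f)"
  proof -
    have "col ?F 0 = f" using f by (auto intro: eq_vecI)
    thus ?thesis using mat_trace_gram[OF F I] by simp
  qed
  hence e: "(?F\<^sup>T * mat_inv M * ?F) $$ (0, 0) = f \<bullet> (mat_inv M *\<^sub>v f)" by (simp add: mat_trace_def)
  have "det (M + ?F * ?F\<^sup>T) = det M * det (1\<^sub>m 1 + ?F\<^sup>T * mat_inv M * ?F)"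
    by (rule det_add_mult[OF MC spd_mat_det_nonzero[OF M] F]) simp
  also have "det (1\<^sub>m 1 + ?F\<^sup>T * mat_inv M * ?F) = 1 + f \<bullet> (mat_inv M *\<^sub>v f)"
    using e by (subst det_single) auto
  finally show ?thesis by (simp add: FF)
qed

text \<open>The bounds on the determinant, by induction on the number of columns of \<open>F\<close>; the hypothesis
  \<open>R \<le> M\<close> persists when columns are added, which keeps each factor below the one computed with \<open>R\<close>.
  That \<open>det M\<close> is positive also follows from definiteness, but it is assumed because the
  induction itself carries it along and, where it is used, \<open>det M\<close> is known explicitly.\<close>
lemma det_add_gram_bounds:
  assumes M: "spd_mat n M" and R: "spd_mat n R" and d: "det M > 0"
    and le: "\<And>x. x \<in> carrier_vec n \<Longrightarrow> x \<bullet> (R *\<^sub>v x) \<le> x \<bullet> (M *\<^sub>v x)"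
    and F: "F \<in> carrier_mat n p"
  shows "det M \<le> det (M + F * F\<^sup>T) \<and>
         det (M + F * F\<^sup>T) \<le> det M * exp (mat_trace (F\<^sup>T * mat_inv R * F))"
  using F
proof (induction p arbitrary: F)
  case 0
  have "F * F\<^sup>T = 0\<^sub>m n n" using 0 by (intro eq_matI) (auto simp: scalar_prod_def)
  thus ?case using 0 spd_matD(1)[OF M] by (simp add: mat_trace_def)
next
  case (Suc p)
  define G where "G = mat n p (\<lambda>ij. F $$ ij)"
  define f where "f = col F p"
  define N where "N = M + G * G\<^sup>T"
  define q where "q = f \<bullet> (mat_inv N *\<^sub>v f)"
  define r where "r = f \<bullet> (mat_inv R *\<^sub>v f)"
  have MC: "M \<in> carrier_mat n n" by (rule spd_matD(1)[OF M])
  have W: "mat_inv R \<in> carrier_mat n n" by (rule spd_mat_inv(1)[OF R])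
  have G: "G \<in> carrier_mat n p" by (simp add: G_def)
  have f: "f \<in> carrier_vec n" using Suc.prems by (auto simp: f_def)
  have N: "spd_mat n N" unfolding N_def by (rule spd_mat_add_gram[OF M G])
  have colG: "col G i = col F i" if "i < p" for i
    using that Suc.prems by (intro eq_vecI) (auto simp: G_def)
  \<comment> \<open>Separate the last column from the other ones.\<close>
  have split: "M + F * F\<^sup>T = N + mat n n (\<lambda>(a, b). f $ a * f $ b)"
    using MC Suc.prems
    by (intro eq_matI) (auto simp: N_def G_def f_def scalar_prod_def)
  have tr: "mat_trace (F\<^sup>T * mat_inv R * F) = mat_trace (G\<^sup>T * mat_inv R * G) + r"
    using mat_trace_gram[OF Suc.prems W] mat_trace_gram[OF G W] colG
    by (simp add: r_def f_def)
  have q0: "0 \<le> q" unfolding q_def by (rule spd_matD(4)[OF spd_mat_inv_spd[OF N] f])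
  have qr: "q \<le> r"
  proof -
    have "x \<bullet> (R *\<^sub>v x) \<le> 1 * (x \<bullet> (N *\<^sub>v x))" if x: "x \<in> carrier_vec n" for x
      using le[OF x] sum_nonneg[of "{..<p}" "\<lambda>i. (col G i \<bullet> x)\<^sup>2"]
      by (simp add: N_def quad_form_add_gram[OF MC G x])
    from quad_form_inv_antimono[OF N R f _ this] show ?thesis by (simp add: q_def r_def)
  qed
  have IH: "det M \<le> det N" "det N \<le> det M * exp (mat_trace (G\<^sup>T * mat_inv R * G))"
    using Suc.IH[OF G] by (simp_all add: N_def)
  have det: "det (M + F * F\<^sup>T) = det N * (1 + q)"
    unfolding split q_def by (rule det_add_rank_one[OF N f])
  have "det N * 1 \<le> det N * (1 + q)" using q0 IH d by (intro mult_left_mono) auto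
  moreover have "det N * (1 + q) \<le> det M * exp (mat_trace (G\<^sup>T * mat_inv R * G)) * exp r"
    using q0 qr d IH order_trans[OF _ exp_ge_add_one_self[of r], of "1 + q"]
    by (intro mult_mono) auto
  ultimately show ?case using IH by (simp add: det tr exp_add)
qed

lemma spd_diagonal_det_pos:
  assumes R: "spd_mat n R" and diag: "diagonal_mat R"
  shows "det R > 0"
proof -
  have RC: "R \<in> carrier_mat n n" by (rule spd_matD(1)[OF R])
  have "R $$ (i, i) > 0" if i: "i < n" for i
  proof -
    have "unit_vec n i \<bullet> (R *\<^sub>v unit_vec n i) = R $$ (i, i)"
      using i RC by (simp add: scalar_prod_left_unit[of _ n])
    moreover have "unit_vec n i \<noteq> (0\<^sub>v n :: real vec)"
      using i by (metis index_unit_vec(2) index_zero_vec(1) zero_neq_one)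
    ultimately show ?thesis using spd_matD(3)[OF R, of "unit_vec n i"] by simp
  qed
  moreover have "det R = prod_list (diag_mat R)"
    using diag RC by (intro det_upper_triangular) (auto simp: diagonal_mat_def)
  ultimately show ?thesis using RC by (auto simp: prod_list_diag_prod intro!: prod_pos)
qed

lemma det_one_add_gram_ge_one:
  assumes "F \<in> carrier_mat n p"
  shows "det (1\<^sub>m n + F * F\<^sup>T :: real mat) \<ge> 1"
  using det_add_gram_bounds[OF spd_mat_one spd_mat_one _ _ assms] by simp

section \<open>Splitting along an orthogonal projector\<close>

context
  fixes Y :: "real mat" and n k :: nat
  assumes Y: "Y \<in> carrier_mat n k" and YY: "Y\<^sup>T * Y = 1\<^sub>m k"
begin

lemma projector_sym: "(Y * Y\<^sup>T)\<^sup>T = Y * Y\<^sup>T"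
  using transpose_mult[of Y n k "Y\<^sup>T" n] Y by simp

lemma projector_idem: "(Y * Y\<^sup>T) * (Y * Y\<^sup>T) = Y * Y\<^sup>T"
proof -
  have "(Y * Y\<^sup>T) * (Y * Y\<^sup>T) = Y * (Y\<^sup>T * (Y * Y\<^sup>T))"
    using Y by (simp add: assoc_mult_mat[of _ n k _ n _ n])
  also have "Y\<^sup>T * (Y * Y\<^sup>T) = (Y\<^sup>T * Y) * Y\<^sup>T"
    using Y by (simp add: assoc_mult_mat[of _ k n _ k _ n])
  finally show ?thesis using Y by (simp add: YY)
qed

lemma complementary_projector_sym: "(1\<^sub>m n - Y * Y\<^sup>T)\<^sup>T = 1\<^sub>m n - Y * Y\<^sup>T"
  using transpose_minus[of "1\<^sub>m n" n n "Y * Y\<^sup>T"] Y by (simp add: projector_sym)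

lemma complementary_projector_idem:
  "(1\<^sub>m n - Y * Y\<^sup>T) * (1\<^sub>m n - Y * Y\<^sup>T) = 1\<^sub>m n - Y * Y\<^sup>T"
proof -
  define P where "P = Y * Y\<^sup>T"
  have P: "P \<in> carrier_mat n n" using Y by (simp add: P_def)
  have "(1\<^sub>m n - P) * (1\<^sub>m n - P) = 1\<^sub>m n * (1\<^sub>m n - P) - P * (1\<^sub>m n - P)"
    using P by (intro minus_mult_distrib_mat[of _ n n _ _ n]) auto
  also have "P * (1\<^sub>m n - P) = P * 1\<^sub>m n - P * P"
    using P by (intro mult_minus_distrib_mat[of _ n n _ n]) auto
  also have "P * P = P" by (simp only: P_def projector_idem)
  finally have "(1\<^sub>m n - P) * (1\<^sub>m n - P) = 1\<^sub>m n * (1\<^sub>m n - P) - (P * 1\<^sub>m n - P)" .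
  also have "\<dots> = 1\<^sub>m n - P" using P by (intro eq_matI) auto
  finally show ?thesis by (simp only: P_def)
qed

text \<open>The contribution of \<open>K\<close> splits into the part seen through the columns of \<open>Y\<close> and the part on
  their orthogonal complement; there are no cross terms.\<close>
lemma gram_projector_split:
  assumes K: "K \<in> carrier_mat m n"
  defines "F \<equiv> K * (1\<^sub>m n - Y * Y\<^sup>T)"
  shows "K * K\<^sup>T = (K * Y) * (K * Y)\<^sup>T + F * F\<^sup>T"
proof -
  let ?P = "Y * Y\<^sup>T" and ?C = "1\<^sub>m n - Y * Y\<^sup>T"
  have P: "?P \<in> carrier_mat n n" and C: "?C \<in> carrier_mat n n" using Y by auto
  have "F * F\<^sup>T = (K * ?C) * (?C * K\<^sup>T)"
    using K C by (simp add: F_def transpose_mult[of K m n ?C n] complementary_projector_sym)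
  also have "\<dots> = K * (?C * ?C) * K\<^sup>T"
    using K C by (simp add: assoc_mult_mat[of _ m n _ n _ m] assoc_mult_mat[of _ m n _ n _ n]
       assoc_mult_mat[of _ n n _ n _ m])
  also have "\<dots> = K * K\<^sup>T - K * ?P * K\<^sup>T"
    using K P by (simp add: complementary_projector_idem mult_minus_distrib_mat[of _ m n _ n]
       minus_mult_distrib_mat[of _ m n _ _ m])
  also have "K * ?P * K\<^sup>T = (K * Y) * (K * Y)\<^sup>T"
    using K Y by (simp add: transpose_mult[of K m n Y k] assoc_mult_mat[of _ m n _ n _ m]
       assoc_mult_mat[of _ n k _ n _ m] assoc_mult_mat[of _ m n _ k _ m])
  finally have e: "F * F\<^sup>T = K * K\<^sup>T - (K * Y) * (K * Y)\<^sup>T" .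
  show ?thesis unfolding e using K Y by (intro eq_matI) auto
qed

text \<open>A projector \<open>E\<close> satisfies \<open>tr (E * H * E) = tr (E * H)\<close>, and the right-hand side is linear in \<open>E\<close>.\<close>
lemma trace_projector_split:
  assumes K: "K \<in> carrier_mat m n" and W: "W \<in> carrier_mat m m"
  defines "F \<equiv> K * (1\<^sub>m n - Y * Y\<^sup>T)" and "H \<equiv> K\<^sup>T * W * K"
  shows "mat_trace (F\<^sup>T * W * F) = mat_trace H - mat_trace ((Y * Y\<^sup>T) * H * (Y * Y\<^sup>T))"
proof -
  let ?P = "Y * Y\<^sup>T" and ?C = "1\<^sub>m n - Y * Y\<^sup>T"
  have P: "?P \<in> carrier_mat n n" and C: "?C \<in> carrier_mat n n" using Y by auto
  have H: "H \<in> carrier_mat n n" using K W by (simp add: H_def)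
  have compress: "mat_trace (E * H * E) = mat_trace (E * H)"
    if "E \<in> carrier_mat n n" "E * E = E" for E
  proof -
    have "mat_trace (E * H * E) = mat_trace (E * (E * H))"
      using that H by (intro mat_trace_comm[of _ n n]) auto
    also have "E * (E * H) = (E * E) * H"
      using that(1) H by (simp add: assoc_mult_mat[of _ n n _ n _ n])
    finally show ?thesis by (simp add: that(2))
  qed
  have "F\<^sup>T * W * F = (?C * K\<^sup>T) * W * (K * ?C)"
    using K C by (simp add: F_def transpose_mult[of K m n ?C n] complementary_projector_sym)
  also have "\<dots> = ?C * H * ?C"
    using K C W by (simp add: H_def assoc_mult_mat[of _ n n _ m _ m] assoc_mult_mat[of _ n m _ m _ n]
      assoc_mult_mat[of _ n n _ m _ n] assoc_mult_mat[of _ n m _ n _ n]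
      assoc_mult_mat[of _ m m _ n _ n] assoc_mult_mat[of _ n n _ n _ n] )
  finally have "mat_trace (F\<^sup>T * W * F) = mat_trace (?C * H)"
    using compress[OF C complementary_projector_idem] by simp
  also have "?C * H = H - ?P * H"
    using P H by (simp add: minus_mult_distrib_mat[of _ n n _ _ n])
  also have "mat_trace \<dots> = mat_trace H - mat_trace (?P * H * ?P)"
    using P H compress[OF P projector_idem] by (simp add: mat_trace_minus[of _ n])
  finally show ?thesis .
qed

end

section \<open>Reduction to the small matrix\<close>

context
  fixes R U B :: "real mat" and m l k :: nat
  assumes R: "spd_mat m R" and U: "U \<in> carrier_mat m l" and B: "B \<in> carrier_mat l k"
    and UWU: "U\<^sup>T * mat_inv R * U = 1\<^sub>m l"
begin

lemma det_reduced:
  "det (R + (U * B) * (U * B)\<^sup>T) = det R * det (1\<^sub>m l + B * B\<^sup>T)"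
proof -
  note RC = spd_matD(1)[OF R] and W = spd_mat_inv(1)[OF R]
  have "det (R + (U * B) * (U * B)\<^sup>T) = det R * det (1\<^sub>m k + (U * B)\<^sup>T * mat_inv R * (U * B))"
    using U B by (intro det_add_mult[OF RC spd_mat_det_nonzero[OF R]]) auto
  also have "(U * B)\<^sup>T * mat_inv R * (U * B) = B\<^sup>T * (U\<^sup>T * mat_inv R * U) * B"
    using U B W by (simp add: transpose_mult[OF U B] assoc_mult_mat[of _ k l _ m _ m]
      assoc_mult_mat[of _ k m _ m _ k] assoc_mult_mat[of _ k l _ m _ k] assoc_mult_mat[of _ k l _ l _ k]
      assoc_mult_mat[of _ l m _ m _ k] assoc_mult_mat[of _ l m _ m _ l] assoc_mult_mat[of _ m m _ l _ k]
      assoc_mult_mat[of _ l m _ l _ k])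
  also have "\<dots> = B\<^sup>T * B" using B by (simp add: UWU)
  also have "det (1\<^sub>m k + B\<^sup>T * B) = det (1\<^sub>m l + B * B\<^sup>T)"
    using B by (intro det_one_plus_mult_commute) auto
  finally show ?thesis .
qed

text \<open>On the range of \<open>U\<close> the large system reduces to the small one: the inverse of
  \<open>R + (U * B) * (U * B)\<^sup>T\<close> sends \<open>U e\<close> to \<open>R\<^sup>-\<^sup>1 U y\<close>, where \<open>(1 + B * B\<^sup>T) y = e\<close>.\<close>
lemma quad_form_inv_reduced:
  assumes e: "e \<in> carrier_vec l"
  shows "(U *\<^sub>v e) \<bullet> (mat_inv (R + (U * B) * (U * B)\<^sup>T) *\<^sub>v (U *\<^sub>v e))
       = e \<bullet> (mat_inv (1\<^sub>m l + B * B\<^sup>T) *\<^sub>v e)"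
proof -
  define W where "W = mat_inv R"
  define \<Theta> where "\<Theta> = 1\<^sub>m l + B * B\<^sup>T"
  define M where "M = R + (U * B) * (U * B)\<^sup>T"
  define y where "y = mat_inv \<Theta> *\<^sub>v e"
  define x where "x = W *\<^sub>v (U *\<^sub>v y)"
  have RC: "R \<in> carrier_mat m m" and W: "W \<in> carrier_mat m m"
    using spd_matD(1)[OF R] spd_mat_inv(1)[OF R] by (auto simp: W_def)
  have T: "spd_mat l \<Theta>" unfolding \<Theta>_def by (rule spd_mat_add_gram[OF spd_mat_one B])
  have M: "spd_mat m M" unfolding M_def by (rule spd_mat_add_gram[OF R]) (use U B in auto)
  have y: "y \<in> carrier_vec l" "\<Theta> *\<^sub>v y = e" using spd_mat_inv_mult_vec[OF T e] by (auto simp: y_def)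
  have Uy: "U *\<^sub>v y \<in> carrier_vec m" using U y by simp
  have x: "x \<in> carrier_vec m" using W Uy by (simp add: x_def)
  have UTx: "U\<^sup>T *\<^sub>v x = y"
  proof -
    have "U\<^sup>T *\<^sub>v x = (U\<^sup>T * W * U) *\<^sub>v y"
      using U W y Uy by (simp add: x_def assoc_mult_mat_vec[of _ l m _ m] assoc_mult_mat_vec[of _ l m _ l])
    thus ?thesis using y by (simp add: UWU W_def)
  qed
  have "M *\<^sub>v x = R *\<^sub>v x + ((U * B) * (U * B)\<^sup>T) *\<^sub>v x"
    unfolding M_def using RC U B x by (intro add_mult_distrib_mat_vec[of _ m m]) auto
  also have "R *\<^sub>v x = U *\<^sub>v y" unfolding x_def W_def by (rule spd_mat_inv_mult_vec(2)[OF R Uy])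
  also have "((U * B) * (U * B)\<^sup>T) *\<^sub>v x = U *\<^sub>v ((B * B\<^sup>T) *\<^sub>v (U\<^sup>T *\<^sub>v x))"
    using U B x by (simp add: transpose_mult[OF U B] assoc_mult_mat_vec[of _ m k _ m]
      assoc_mult_mat_vec[of _ m l _ k] assoc_mult_mat_vec[of _ k l _ m] assoc_mult_mat_vec[of _ l k _ l])
  also have "U *\<^sub>v y + U *\<^sub>v ((B * B\<^sup>T) *\<^sub>v (U\<^sup>T *\<^sub>v x)) = U *\<^sub>v (\<Theta> *\<^sub>v y)"
    unfolding UTx \<Theta>_def using U B y
    by (simp add: add_mult_distrib_mat_vec[of _ l l] mult_add_distrib_mat_vec[of _ m l])
  finally have "M *\<^sub>v x = U *\<^sub>v e" by (simp add: y)
  hence "mat_inv M *\<^sub>v (U *\<^sub>v e) = x" using spd_mat_inv_mult_vec(3)[OF M x] by simp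
  hence "(U *\<^sub>v e) \<bullet> (mat_inv M *\<^sub>v (U *\<^sub>v e)) = x \<bullet> (U *\<^sub>v e)"
    using U e x by (simp add: comm_scalar_prod[of _ m])
  also have "\<dots> = (U\<^sup>T *\<^sub>v x) \<bullet> e" using transpose_vec_mult_scalar[OF U e x] by simp
  also have "\<dots> = e \<bullet> y" using e y by (simp add: UTx comm_scalar_prod[of _ l])
  finally show ?thesis by (simp add: M_def y_def \<Theta>_def)
qed

end

section \<open>Orthogonality and the bidiagonal relation for the Golub-Kahan process\<close>

text \<open>The induction behind the orthogonality, for the numbers \<open>gu i j\<close>, \<open>gv i j\<close> (the inner products of the
  \<open>u i\<close> and of the \<open>v i\<close>) and \<open>c i j\<close> (the mixed ones of \<open>u i\<close> with \<open>A Q (v j)\<close>).  Both recurrences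
  express \<open>c\<close>; equating the two expressions annihilates the new off-diagonal entries,
  first those of \<open>gu\<close> and then those of \<open>gv\<close>.\<close>
lemma genGK_gram_orthonormal:
  fixes gu gv c :: "nat \<Rightarrow> nat \<Rightarrow> real" and \<alpha> \<beta> :: "nat \<Rightarrow> real"
  assumes symu: "\<And>i j. i \<in> {1..k+1} \<Longrightarrow> j \<in> {1..k+1} \<Longrightarrow> gu i j = gu j i"
    and symv: "\<And>i j. i \<in> {1..k+1} \<Longrightarrow> j \<in> {1..k+1} \<Longrightarrow> gv i j = gv j i"
    and nu: "\<And>i. i \<in> {1..k+1} \<Longrightarrow> gu i i = 1" and nv: "\<And>i. i \<in> {1..k+1} \<Longrightarrow> gv i i = 1"
    and \<alpha>: "\<And>i. i \<in> {1..k+1} \<Longrightarrow> \<alpha> i > 0" and \<beta>: "\<And>i. i \<in> {1..k+1} \<Longrightarrow> \<beta> i > 0"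
    and u: "\<And>i j. i \<in> {1..k+1} \<Longrightarrow> j \<in> {1..k} \<Longrightarrow> \<beta> (j+1) * gu (j+1) i = c i j - \<alpha> j * gu j i"
    and v1: "\<And>i. i \<in> {1..k+1} \<Longrightarrow> \<alpha> 1 * gv 1 i = c 1 i"
    and v: "\<And>i j. i \<in> {1..k+1} \<Longrightarrow> j \<in> {1..k} \<Longrightarrow>
              \<alpha> (j+1) * gv (j+1) i = c (j+1) i - \<beta> (j+1) * gv j i"
  shows "\<forall>i \<in> {1..k+1}. \<forall>j \<in> {1..k+1}. i \<noteq> j \<longrightarrow> gu i j = 0 \<and> gv i j = 0"
proof -
  \<comment> \<open>Only the entries below the diagonal; symmetry gives the others.\<close>
  have *: "\<forall>i j. 1 \<le> i \<longrightarrow> i < j \<longrightarrow> j \<le> l \<longrightarrow> gu j i = 0 \<and> gv j i = 0" if "l \<le> k + 1" for l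
    using that
  proof (induction l)
    case 0
    thus ?case by auto
  next
    case (Suc l)
    have IH: "gu j i = 0" "gv j i = 0" "gu i j = 0" "gv i j = 0"
      if "1 \<le> i" "i < j" "j \<le> l" for i j
      using Suc.IH Suc.prems that symu[of i j] symv[of i j] by auto
    have gu0: "gu (l+1) i = 0" if i: "1 \<le> i" "i \<le> l" for i
    proof -
      have 1: "\<beta> (l+1) * gu (l+1) i = c i l - \<alpha> l * gu l i"
        using u[of i l] i Suc.prems by auto
      \<comment> \<open>There is no \<open>v 0\<close>: for \<open>i = 1\<close> the starting relation replaces the recurrence.\<close>
      have "c i l = \<alpha> i * gv i l + (if i = 1 then 0 else \<beta> i * gv (i-1) l)"
      proof (cases "i = 1")
        case True
        thus ?thesis using v1[of l] i Suc.prems by auto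
      next
        case False
        hence "i - 1 \<in> {1..k}" "i - 1 + 1 = i" using i Suc.prems by auto
        thus ?thesis using v[of l "i-1"] False i Suc.prems by auto
      qed
      moreover have "gv (i-1) l = 0" if "i \<noteq> 1" using IH(4)[of "i-1" l] that i by auto
      ultimately have "c i l = \<alpha> i * gv i l" by auto
      hence "\<beta> (l+1) * gu (l+1) i = 0"
        using 1 IH(1)[of i l] IH(4)[of i l] nu[of l] nv[of l] i Suc.prems by (cases "i = l") auto
      thus ?thesis using \<beta>[of "l+1"] Suc.prems by auto
    qed
    have gv0: "gv (l+1) i = 0" if i: "1 \<le> i" "i \<le> l" for i
    proof -
      have 1: "\<alpha> (l+1) * gv (l+1) i = c (l+1) i - \<beta> (l+1) * gv l i"
        using v[of i l] i Suc.prems by auto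
      have "c (l+1) i = \<beta> (i+1) * gu (i+1) (l+1) + \<alpha> i * gu i (l+1)"
        using u[of "l+1" i] i Suc.prems by auto
      also have "gu i (l+1) = 0" using gu0[OF i] symu[of i "l+1"] i Suc.prems by auto
      finally have "\<alpha> (l+1) * gv (l+1) i = 0"
        using 1 IH(2)[of i l] gu0[of "i+1"] symu[of "i+1" "l+1"] nu[of "l+1"] nv[of l] i Suc.prems
        by (cases "i = l") auto
      thus ?thesis using \<alpha>[of "l+1"] Suc.prems by auto
    qed
    show ?case using IH gu0 gv0 by (auto simp: le_Suc_eq)
  qed
  show ?thesis
  proof (intro ballI impI)
    fix i j assume "i \<in> {1..k+1}" "j \<in> {1..k+1}" "i \<noteq> j"
    thus "gu i j = 0 \<and> gv i j = 0"
      using *[of "k+1"] symu[of i j] symv[of i j] by (cases "i < j") auto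
  qed
qed

context
  fixes m n k :: nat and A R Q :: "real mat" and \<mu> d :: "real vec"
    and \<alpha> \<beta> :: "nat \<Rightarrow> real" and u v :: "nat \<Rightarrow> real vec"
  assumes A: "A \<in> carrier_mat m n" and R: "spd_mat m R" and Q: "spd_mat n Q"
    and gk: "genGK m n A R Q \<mu> d k \<alpha> \<beta> u v"
begin

lemma genGKD:
  assumes "i \<in> {1..k+1}"
  shows "u i \<in> carrier_vec m" "v i \<in> carrier_vec n" "u i \<bullet> (mat_inv R *\<^sub>v u i) = 1"
    "v i \<bullet> (Q *\<^sub>v v i) = 1" "\<alpha> i > 0" "\<beta> i > 0"
proof -
  show 1: "u i \<in> carrier_vec m" "v i \<in> carrier_vec n" "\<alpha> i > 0" "\<beta> i > 0"
    using gk assms unfolding genGK_def by auto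
  have "mat_norm (mat_inv R) (u i) = 1" "mat_norm Q (v i) = 1"
    using gk assms unfolding genGK_def by auto
  thus "u i \<bullet> (mat_inv R *\<^sub>v u i) = 1" "v i \<bullet> (Q *\<^sub>v v i) = 1"
    using mat_norm_power2[OF spd_mat_inv_spd[OF R] 1(1)] mat_norm_power2[OF Q 1(2)] by auto
qed

lemma genGK_orthonormal:
  assumes "i \<in> {1..k+1}" "j \<in> {1..k+1}"
  shows "u i \<bullet> (mat_inv R *\<^sub>v u j) = (if i = j then 1 else 0)"
    and "v i \<bullet> (Q *\<^sub>v v j) = (if i = j then 1 else 0)"
proof -
  define W where "W = mat_inv R"
  have WS: "spd_mat m W" unfolding W_def by (rule spd_mat_inv_spd[OF R])
  have W: "W \<in> carrier_mat m m" and QC: "Q \<in> carrier_mat n n" using spd_matD(1)[OF WS] spd_matD(1)[OF Q] .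
  note c = genGKD(1,2)
  have adj: "(A\<^sup>T *\<^sub>v (W *\<^sub>v u i)) \<bullet> (Q *\<^sub>v v j) = (A *\<^sub>v (Q *\<^sub>v v j)) \<bullet> (W *\<^sub>v u i)"
    if "i \<in> {1..k+1}" "j \<in> {1..k+1}" for i j
  proof -
    have w: "Q *\<^sub>v v j \<in> carrier_vec n" "W *\<^sub>v u i \<in> carrier_vec m" using c[OF that(1)] c[OF that(2)] QC W by auto
    show ?thesis using transpose_vec_mult_scalar[OF A w] A w by (simp add: comm_scalar_prod[of _ m])
  qed
  have "\<forall>i \<in> {1..k+1}. \<forall>j \<in> {1..k+1}. i \<noteq> j \<longrightarrow> u i \<bullet> (W *\<^sub>v u j) = 0 \<and> v i \<bullet> (Q *\<^sub>v v j) = 0"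
  proof (rule genGK_gram_orthonormal[where \<alpha> = \<alpha> and \<beta> = \<beta> and k = k
      and c = "\<lambda>i j. (A *\<^sub>v (Q *\<^sub>v v j)) \<bullet> (W *\<^sub>v u i)"])
    fix i j assume ij: "i \<in> {1..k+1}" "j \<in> {1..k+1}"
    show "u i \<bullet> (W *\<^sub>v u j) = u j \<bullet> (W *\<^sub>v u i)"
      using symmetric_bilinear[OF W spd_matD(2)[OF WS]] c ij by blast
    show "v i \<bullet> (Q *\<^sub>v v j) = v j \<bullet> (Q *\<^sub>v v i)"
      using symmetric_bilinear[OF QC spd_matD(2)[OF Q]] c ij by blast
  next
    fix i j assume i: "i \<in> {1..k+1}" and j: "j \<in> {1..k}"
    hence j': "j \<in> {1..k+1}" "j + 1 \<in> {1..k+1}" by auto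
    have Wu: "W *\<^sub>v u i \<in> carrier_vec m" and Qv: "Q *\<^sub>v v i \<in> carrier_vec n"
      and Wu': "W *\<^sub>v u (j+1) \<in> carrier_vec m" and Qv': "Q *\<^sub>v v j \<in> carrier_vec n"
      using W QC c[OF i] c[OF j'(1)] c[OF j'(2)] by auto
    have "\<beta> (j+1) * (u (j+1) \<bullet> (W *\<^sub>v u i)) = (\<beta> (j+1) \<cdot>\<^sub>v u (j+1)) \<bullet> (W *\<^sub>v u i)"
      using Wu c[OF j'(2)] by simp
    also have "\<beta> (j+1) \<cdot>\<^sub>v u (j+1) = A *\<^sub>v (Q *\<^sub>v v j) - \<alpha> j \<cdot>\<^sub>v u j"
      using gk j unfolding genGK_def by auto
    also have "\<dots> \<bullet> (W *\<^sub>v u i) = (A *\<^sub>v (Q *\<^sub>v v j)) \<bullet> (W *\<^sub>v u i) - \<alpha> j * (u j \<bullet> (W *\<^sub>v u i))"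
      using Wu Qv' c[OF j'(1)] A by (simp add: minus_scalar_prod_distrib[of _ m])
    finally show "\<beta> (j+1) * (u (j+1) \<bullet> (W *\<^sub>v u i)) = (A *\<^sub>v (Q *\<^sub>v v j)) \<bullet> (W *\<^sub>v u i) - \<alpha> j * (u j \<bullet> (W *\<^sub>v u i))" .
    have "\<alpha> (j+1) * (v (j+1) \<bullet> (Q *\<^sub>v v i)) = (\<alpha> (j+1) \<cdot>\<^sub>v v (j+1)) \<bullet> (Q *\<^sub>v v i)"
      using Qv c[OF j'(2)] by simp
    also have "\<alpha> (j+1) \<cdot>\<^sub>v v (j+1) = A\<^sup>T *\<^sub>v (W *\<^sub>v u (j+1)) - \<beta> (j+1) \<cdot>\<^sub>v v j"
      using gk j unfolding genGK_def W_def by auto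
    also have "\<dots> \<bullet> (Q *\<^sub>v v i) = (A\<^sup>T *\<^sub>v (W *\<^sub>v u (j+1))) \<bullet> (Q *\<^sub>v v i) - \<beta> (j+1) * (v j \<bullet> (Q *\<^sub>v v i))"
      using Wu' Qv c[OF j'(1)] A by (simp add: minus_scalar_prod_distrib[of _ n])
    finally show "\<alpha> (j+1) * (v (j+1) \<bullet> (Q *\<^sub>v v i)) = (A *\<^sub>v (Q *\<^sub>v v i)) \<bullet> (W *\<^sub>v u (j+1)) - \<beta> (j+1) * (v j \<bullet> (Q *\<^sub>v v i))"
      using adj[OF j'(2) i] by simp
  next
    fix i assume i: "i \<in> {1..k+1}"
    have o: "1 \<in> {1..k+1}" by simp
    have "\<alpha> 1 * (v 1 \<bullet> (Q *\<^sub>v v i)) = (\<alpha> 1 \<cdot>\<^sub>v v 1) \<bullet> (Q *\<^sub>v v i)"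
      using QC c[OF i] c[OF o] by simp
    also have "\<alpha> 1 \<cdot>\<^sub>v v 1 = A\<^sup>T *\<^sub>v (W *\<^sub>v u 1)"
      using gk unfolding genGK_def W_def by auto
    finally show "\<alpha> 1 * (v 1 \<bullet> (Q *\<^sub>v v i)) = (A *\<^sub>v (Q *\<^sub>v v i)) \<bullet> (W *\<^sub>v u 1)"
      using adj[OF o i] by simp
  qed (use genGKD in \<open>auto simp: W_def\<close>)
  thus "u i \<bullet> (mat_inv R *\<^sub>v u j) = (if i = j then 1 else 0)"
    "v i \<bullet> (Q *\<^sub>v v j) = (if i = j then 1 else 0)"
    using assms genGKD(3,4) by (auto simp: W_def)
qed

lemma genGK_gram_mat:
  defines "U \<equiv> mat_of_cols m (map u [1..<k+2])" and "V \<equiv> mat_of_cols n (map v [1..<k+1])"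
  shows "U\<^sup>T * mat_inv R * U = 1\<^sub>m (k+1)" "V\<^sup>T * Q * V = 1\<^sub>m k"
proof -
  have W: "mat_inv R \<in> carrier_mat m m" by (rule spd_mat_inv(1)[OF R])
  have QC: "Q \<in> carrier_mat n n" by (rule spd_matD(1)[OF Q])
  have U: "U \<in> carrier_mat m (k+1)" and V: "V \<in> carrier_mat n k" by (auto simp: U_def V_def simp del: upt_Suc)
  have cU: "col U i = u (i+1)" if "i < k+1" for i
    using that genGKD(1)[of "i+1"] by (simp add: U_def del: upt_Suc)
  have cV: "col V i = v (i+1)" if "i < k" for i
    using that genGKD(2)[of "i+1"] by (simp add: V_def del: upt_Suc)
  show "U\<^sup>T * mat_inv R * U = 1\<^sub>m (k+1)"
    using U W genGK_orthonormal(1)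
    by (intro eq_matI) (auto simp: gram_index[OF U W] cU simp del: index_mult_mat(1) assoc_mult_mat)
  show "V\<^sup>T * Q * V = 1\<^sub>m k"
    using V QC genGK_orthonormal(2)
    by (intro eq_matI) (auto simp: gram_index[OF V QC] cV simp del: index_mult_mat(1) assoc_mult_mat)
qed

lemma genGK_bidiag:
  defines "U \<equiv> mat_of_cols m (map u [1..<k+2])" and "V \<equiv> mat_of_cols n (map v [1..<k+1])"
  shows "A * Q * V = U * bidiag_mat k \<alpha> \<beta>"
proof (rule eq_matI)
  have QC: "Q \<in> carrier_mat n n" by (rule spd_matD(1)[OF Q])
  have U: "U \<in> carrier_mat m (k+1)" and V: "V \<in> carrier_mat n k" by (auto simp: U_def V_def simp del: upt_Suc)
  have B: "bidiag_mat k \<alpha> \<beta> \<in> carrier_mat (k+1) k" by (simp add: bidiag_mat_def)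
  show "dim_row (A * Q * V) = dim_row (U * bidiag_mat k \<alpha> \<beta>)"
    "dim_col (A * Q * V) = dim_col (U * bidiag_mat k \<alpha> \<beta>)" using A U V B by auto
  fix i j assume "i < dim_row (U * bidiag_mat k \<alpha> \<beta>)" "j < dim_col (U * bidiag_mat k \<alpha> \<beta>)"
  hence i: "i < m" and j: "j < k" using U B by auto
  have cV: "col V j = v (j+1)"
    using j genGKD(2)[of "j+1"] by (simp add: V_def del: upt_Suc)
  have uc: "u (j+1) \<in> carrier_vec m" "u (j+2) \<in> carrier_vec m" "v (j+1) \<in> carrier_vec n"
    using genGKD(1)[of "j+1"] genGKD(1)[of "j+2"] genGKD(2)[of "j+1"] j by auto
  have "(A * Q * V) $$ (i, j) = (A *\<^sub>v (Q *\<^sub>v v (j+1))) $ i"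
  proof -
    have "col (A * Q * V) j = (A * Q) *\<^sub>v v (j+1)"
      using col_mult2[of "A * Q" m n V k j] A QC V j cV by (simp del: assoc_mult_mat)
    also have "\<dots> = A *\<^sub>v (Q *\<^sub>v v (j+1))" using A QC uc by (simp add: assoc_mult_mat_vec[of _ m n _ n])
    finally show ?thesis using i j A V by (metis index_col carrier_matD index_mult_mat(2,3))
  qed
  also have "\<dots> = \<beta> (j+2) * u (j+2) $ i + \<alpha> (j+1) * u (j+1) $ i"
  proof -
    have "\<beta> (j+1+1) \<cdot>\<^sub>v u (j+1+1) = A *\<^sub>v (Q *\<^sub>v v (j+1)) - \<alpha> (j+1) \<cdot>\<^sub>v u (j+1)"
      using gk j unfolding genGK_def by auto
    from arg_cong[OF this, of "\<lambda>w. w $ i"] show ?thesis using i uc A by simp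
  qed
  also have "\<dots> = (U * bidiag_mat k \<alpha> \<beta>) $$ (i, j)"
  proof -
    have "(U * bidiag_mat k \<alpha> \<beta>) $$ (i, j) = (\<Sum>l<k+1. U $$ (i, l) * bidiag_mat k \<alpha> \<beta> $$ (l, j))"
      using i j U B by (auto simp: scalar_prod_def atLeast0LessThan intro!: sum.cong)
    also have "\<dots> = (\<Sum>l<k+1. (if l = j then u (j+1) $ i * \<alpha> (j+1) else 0)
                       + (if l = j+1 then u (j+2) $ i * \<beta> (j+2) else 0))"
    proof (rule sum.cong)
      fix l assume "l \<in> {..<k+1}"
      hence "l < k + 1" by simp
      thus "U $$ (i, l) * bidiag_mat k \<alpha> \<beta> $$ (l, j) = (if l = j then u (j+1) $ i * \<alpha> (j+1) else 0)
                       + (if l = j+1 then u (j+2) $ i * \<beta> (j+2) else 0)"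
        using i j by (auto simp: U_def mat_of_cols_def bidiag_mat_def simp del: upt_Suc)
    qed simp
    also have "\<dots> = u (j+1) $ i * \<alpha> (j+1) + u (j+2) $ i * \<beta> (j+2)"
      using j by (simp add: sum.distrib)
    finally show ?thesis by simp
  qed
  finally show "(A * Q * V) $$ (i, j) = (U * bidiag_mat k \<alpha> \<beta>) $$ (i, j)" .
qed

end

section \<open>Error bound\<close>

text \<open>The effect of a Gram update on the sum of the log-determinant and the quadratic form of the inverse at
  \<open>r\<close>.  The first grows by at most
  \<open>\<xi>\<close>, the second decreases by at most \<open>\<xi> / (1 + \<xi>)\<close> times the quadratic form of \<open>R\<^sup>-\<^sup>1\<close> at \<open>r\<close>.\<close>
lemma log_det_quad_diff_bound:
  assumes M: "spd_mat m M" and R: "spd_mat m R" and d: "det M > 0"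
    and le: "\<And>x. x \<in> carrier_vec m \<Longrightarrow> x \<bullet> (R *\<^sub>v x) \<le> x \<bullet> (M *\<^sub>v x)"
    and F: "F \<in> carrier_mat m p" and r: "r \<in> carrier_vec m"
  defines "\<xi> \<equiv> mat_trace (F\<^sup>T * mat_inv R * F)" and "N \<equiv> M + F * F\<^sup>T"
  shows "\<bar>(ln (det N) + r \<bullet> (mat_inv N *\<^sub>v r)) - (ln (det M) + r \<bullet> (mat_inv M *\<^sub>v r))\<bar>
     \<le> \<xi> + (r \<bullet> (mat_inv R *\<^sub>v r)) * (\<xi> / (1 + \<xi>))"
proof -
  have MC: "M \<in> carrier_mat m m" by (rule spd_matD(1)[OF M])
  have N: "spd_mat m N" unfolding N_def by (rule spd_mat_add_gram[OF M F])
  have xi: "0 \<le> \<xi>"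
    using mat_trace_gram[OF F spd_mat_inv(1)[OF R]] F
    by (auto simp: \<xi>_def intro!: sum_nonneg spd_matD(4)[OF spd_mat_inv_spd[OF R]])
  have det: "det M \<le> det N" "det N \<le> det M * exp \<xi>"
    using det_add_gram_bounds[OF M R d le F] by (auto simp: N_def \<xi>_def)
  have "ln (det N) \<le> ln (det M * exp \<xi>)" using det d by simp
  hence ld: "ln (det M) \<le> ln (det N)" "ln (det N) \<le> ln (det M) + \<xi>"
    using det d by (simp_all add: ln_mult)
  define qM where "qM = r \<bullet> (mat_inv M *\<^sub>v r)"
  define qN where "qN = r \<bullet> (mat_inv N *\<^sub>v r)"
  define q where "q = r \<bullet> (mat_inv R *\<^sub>v r)"
  have qf: "x \<bullet> (N *\<^sub>v x) = x \<bullet> (M *\<^sub>v x) + (\<Sum>i<p. (col F i \<bullet> x)\<^sup>2)" if "x \<in> carrier_vec m" for x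
    unfolding N_def by (rule quad_form_add_gram[OF MC F that])
  have "qN \<le> 1 * qM" unfolding qN_def qM_def
    by (rule quad_form_inv_antimono[OF N M r]) (auto simp: qf sum_nonneg)
  moreover have "qM \<le> 1 * q" unfolding q_def qM_def
    by (rule quad_form_inv_antimono[OF M R r]) (auto simp: le)
  moreover have "qM \<le> (1 + \<xi>) * qN" unfolding qN_def qM_def
  proof (rule quad_form_inv_antimono[OF M N r])
    fix x :: "real vec" assume x: "x \<in> carrier_vec m"
    have "(\<Sum>i<p. (col F i \<bullet> x)\<^sup>2) \<le> \<xi> * (x \<bullet> (R *\<^sub>v x))"
      unfolding \<xi>_def by (rule quad_form_gram_le_trace[OF R F x])
    also have "\<dots> \<le> \<xi> * (x \<bullet> (M *\<^sub>v x))" using le[OF x] xi by (rule mult_left_mono)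
    finally show "x \<bullet> (N *\<^sub>v x) \<le> (1 + \<xi>) * (x \<bullet> (M *\<^sub>v x))"
      by (simp add: qf[OF x] algebra_simps)
  qed (use xi in simp)
  ultimately have b: "qN \<le> qM" "qM \<le> q" "qM / (1 + \<xi>) \<le> qN"
    using xi by (auto simp: field_simps)
  have "qM - qN \<le> qM - qM / (1 + \<xi>)" using b by simp
  also have "\<dots> = qM * (\<xi> / (1 + \<xi>))" using xi by (simp add: field_simps)
  also have "\<dots> \<le> q * (\<xi> / (1 + \<xi>))" using b xi by (intro mult_right_mono) auto
  finally have c: "qM - qN \<le> q * (\<xi> / (1 + \<xi>))" .
  show ?thesis
    using ld b(1) c xi unfolding qM_def[symmetric] qN_def[symmetric] q_def[symmetric] by linarith
qed

theorem proposition3p2: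
  fixes m n k :: nat
    and A R Q Qhalf Z V B \<Theta> \<Pi>V H Hk :: "real mat"
    and \<mu> d :: "real vec"
    and \<pi>\<theta> Fbar Ftilde \<xi> :: real
    and \<alpha> \<beta> :: "nat \<Rightarrow> real"
    and u v :: "nat \<Rightarrow> real vec"
  assumes "0 < m" and "m \<le> n"
    and "A \<in> carrier_mat m n"
    and "diagonal_mat R" and "spd_mat m R"
    and "spd_mat n Q"
    and "\<mu> \<in> carrier_vec n" and "d \<in> carrier_vec m"
    and "\<pi>\<theta> > 0"
    and "Z = A * Q * A\<^sup>T + R"
    and "Fbar = - ln \<pi>\<theta> + 1/2 * ln (det Z)
                + 1/2 * (mat_norm (mat_inv Z) (A *\<^sub>v \<mu> - d))\<^sup>2"
    and "k \<ge> 1"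
    and "genGK m n A R Q \<mu> d k \<alpha> \<beta> u v"
    and "V = mat_of_cols n (map v [1..<k+1])"
    and "B = bidiag_mat k \<alpha> \<beta>"
    and "\<Theta> = 1\<^sub>m (k+1) + B * B\<^sup>T"
    and "Ftilde = - ln \<pi>\<theta> + 1/2 * ln (det R) + 1/2 * ln (det \<Theta>)
                  + 1/2 * (mat_norm (mat_inv \<Theta>) (\<beta> 1 \<cdot>\<^sub>v unit_vec (k+1) 0))\<^sup>2"
    and "is_spd_sqrt n Q Qhalf"
    and "\<Pi>V = (Qhalf * V) * (Qhalf * V)\<^sup>T"
    and "H = Qhalf * A\<^sup>T * mat_inv R * A * Qhalf"
    and "Hk = \<Pi>V * H * \<Pi>V"
    and "\<xi> = mat_trace H - mat_trace Hk"
  shows "\<bar>Fbar - Ftilde\<bar> \<le> 1/2 * (\<xi> + (\<beta> 1)\<^sup>2 * (\<xi> / (1 + \<xi>)))"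
proof -
  note A = assms(3) and R = assms(5) and Q = assms(6) and gk = assms(13)
  define W where "W = mat_inv R"
  define U where "U = mat_of_cols m (map u [1..<k+2])"
  define K where "K = A * Qhalf"
  define Y where "Y = Qhalf * V"
  define F where "F = K * (1\<^sub>m n - Y * Y\<^sup>T)"
  define M where "M = R + (U * B) * (U * B)\<^sup>T"
  define e where "e = \<beta> 1 \<cdot>\<^sub>v (unit_vec (k+1) 0 :: real vec)"
  define r where "r = A *\<^sub>v \<mu> - d"
  have S: "spd_mat n Qhalf" and SS: "Qhalf * Qhalf = Q"
    using assms(18) by (auto simp: is_spd_sqrt_def)
  have RC: "R \<in> carrier_mat m m" and QC: "Q \<in> carrier_mat n n" and SC: "Qhalf \<in> carrier_mat n n"
    and St: "Qhalf\<^sup>T = Qhalf" and WC: "W \<in> carrier_mat m m"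
    using spd_matD[OF R] spd_matD[OF Q] spd_matD[OF S] spd_mat_inv(1)[OF R] by (auto simp: W_def)
  have UC: "U \<in> carrier_mat m (k+1)" and VC: "V \<in> carrier_mat n k" and BC: "B \<in> carrier_mat (k+1) k"
    by (auto simp: U_def assms(14,15) bidiag_mat_def simp del: upt_Suc)
  have KC: "K \<in> carrier_mat m n" and YC: "Y \<in> carrier_mat n k" and UBC: "U * B \<in> carrier_mat m k"
    using A SC VC UC BC by (auto simp: K_def Y_def)
  have FC: "F \<in> carrier_mat m n" unfolding F_def using YC by (intro mult_carrier_mat[OF KC] minus_carrier_mat) auto
  have ec: "e \<in> carrier_vec (k+1)" by (simp add: e_def)
  have rc: "r \<in> carrier_vec m" using A assms(7,8) by (simp add: r_def)
  have UWU: "U\<^sup>T * mat_inv R * U = 1\<^sub>m (k+1)" and VQV: "V\<^sup>T * Q * V = 1\<^sub>m k"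
    using genGK_gram_mat[OF A R Q gk] by (auto simp: U_def assms(14))
  have AQV: "A * Q * V = U * B"
    using genGK_bidiag[OF A R Q gk] by (simp add: U_def assms(14,15))
  have YY: "Y\<^sup>T * Y = 1\<^sub>m k"
  proof -
    have "Y\<^sup>T * Y = V\<^sup>T * (Qhalf * Qhalf) * V"
      using SC VC by (simp add: Y_def transpose_mult[OF SC VC] St assoc_mult_mat[of _ k n _ n _ k]
        assoc_mult_mat[of _ n n _ n _ k])
    thus ?thesis by (simp add: SS VQV)
  qed
  have KY: "K * Y = U * B"
  proof -
    have "K * Y = A * (Qhalf * Qhalf) * V"
      using SC VC A by (simp add: K_def Y_def assoc_mult_mat[of _ m n _ n _ k]
        assoc_mult_mat[of _ n n _ n _ k])
    thus ?thesis by (simp add: SS AQV)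
  qed
  have KK: "K * K\<^sup>T = A * Q * A\<^sup>T"
  proof -
    have "K * K\<^sup>T = A * (Qhalf * Qhalf) * A\<^sup>T"
      using SC A by (simp add: K_def transpose_mult[OF A SC] St assoc_mult_mat[of _ m n _ n _ m]
        assoc_mult_mat[of _ n n _ n _ m])
    thus ?thesis by (simp add: SS)
  qed
  have Heq: "H = K\<^sup>T * W * K"
    using SC A WC by (simp add: assms(20) W_def[symmetric] K_def transpose_mult[OF A SC] St
      assoc_mult_mat[of _ n m _ n _ n] assoc_mult_mat[of _ n m _ m _ n] assoc_mult_mat[of _ m m _ n _ n])
  have ZM: "Z = M + F * F\<^sup>T"
  proof -
    have "A * Q * A\<^sup>T = (U * B) * (U * B)\<^sup>T + F * F\<^sup>T"
      using gram_projector_split[OF YC YY KC] by (simp add: KK KY F_def)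
    thus ?thesis unfolding assms(10) M_def using RC UBC FC by (intro eq_matI) auto
  qed
  have xi: "\<xi> = mat_trace (F\<^sup>T * mat_inv R * F)"
    using trace_projector_split[OF YC YY KC WC]
    by (simp add: assms(19,21,22) Heq F_def W_def Y_def)
  have M: "spd_mat m M" unfolding M_def by (rule spd_mat_add_gram[OF R UBC])
  have T: "spd_mat (k+1) \<Theta>" unfolding assms(16) by (rule spd_mat_add_gram[OF spd_mat_one BC])
  have Zs: "spd_mat m Z" unfolding ZM by (rule spd_mat_add_gram[OF M FC])
  have dR: "det R > 0" by (rule spd_diagonal_det_pos[OF R assms(4)])
  have dT: "det \<Theta> > 0" using det_one_add_gram_ge_one[OF BC] by (simp add: assms(16))
  have dM: "det M = det R * det \<Theta>"
    unfolding M_def assms(16) by (rule det_reduced[OF R UC BC UWU])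
  have u1: "u 1 \<in> carrier_vec m" "u 1 \<bullet> (mat_inv R *\<^sub>v u 1) = 1"
    using genGKD[OF A R Q gk, of 1] by auto
  have b1: "\<beta> 1 \<cdot>\<^sub>v u 1 = d - A *\<^sub>v \<mu>" using gk by (simp add: genGK_def)
  \<comment> \<open>The objective has the residual with the opposite sign; quadratic forms do not see it.\<close>
  have r: "r = (- \<beta> 1) \<cdot>\<^sub>v u 1"
  proof (rule eq_vecI)
    fix i assume "i < dim_vec ((- \<beta> 1) \<cdot>\<^sub>v u 1)"
    hence i: "i < m" using u1 by simp
    have "(\<beta> 1 \<cdot>\<^sub>v u 1) $ i = (d - A *\<^sub>v \<mu>) $ i" by (simp only: b1)
    thus "r $ i = ((- \<beta> 1) \<cdot>\<^sub>v u 1) $ i" using i u1 A assms(7,8) by (simp add: r_def)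
  qed (use rc u1 in auto)
  have Ue: "U *\<^sub>v e = \<beta> 1 \<cdot>\<^sub>v u 1"
  proof -
    have "U *\<^sub>v unit_vec (k+1) 0 = col U 0"
      using UC by (intro eq_vecI) auto
    also have "\<dots> = u 1" using u1 by (simp add: U_def del: upt_Suc)
    finally show ?thesis using UC by (simp add: e_def mult_mat_vec[of _ m "k+1"])
  qed
  have quad: "r \<bullet> (N *\<^sub>v r) = (\<beta> 1)\<^sup>2 * (u 1 \<bullet> (N *\<^sub>v u 1))"
    "(U *\<^sub>v e) \<bullet> (N *\<^sub>v (U *\<^sub>v e)) = (\<beta> 1)\<^sup>2 * (u 1 \<bullet> (N *\<^sub>v u 1))"
    if "N \<in> carrier_mat m m" for N
    using that u1 by (simp_all add: r Ue mult_mat_vec[of _ m m] power2_eq_square)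
  have qR: "r \<bullet> (mat_inv R *\<^sub>v r) = (\<beta> 1)\<^sup>2"
    using quad(1)[OF spd_mat_inv(1)[OF R]] u1 by simp
  have qM: "r \<bullet> (mat_inv M *\<^sub>v r) = (mat_norm (mat_inv \<Theta>) e)\<^sup>2"
    using quad[OF spd_mat_inv(1)[OF M]] quad_form_inv_reduced[OF R UC BC UWU ec]
      mat_norm_power2[OF spd_mat_inv_spd[OF T] ec]
    by (simp add: M_def assms(16))
  have qZ: "r \<bullet> (mat_inv Z *\<^sub>v r) = (mat_norm (mat_inv Z) r)\<^sup>2"
    by (simp add: mat_norm_power2[OF spd_mat_inv_spd[OF Zs] rc])
  have le: "x \<bullet> (R *\<^sub>v x) \<le> x \<bullet> (M *\<^sub>v x)" if "x \<in> carrier_vec m" for x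
    unfolding M_def quad_form_add_gram[OF RC UBC that] by (simp add: sum_nonneg)
  have "det M > 0" using dM dR dT by simp
  from log_det_quad_diff_bound[OF M R this le FC rc]
  have "\<bar>(ln (det Z) + (mat_norm (mat_inv Z) r)\<^sup>2) - (ln (det M) + (mat_norm (mat_inv \<Theta>) e)\<^sup>2)\<bar>
      \<le> \<xi> + (\<beta> 1)\<^sup>2 * (\<xi> / (1 + \<xi>))"
    by (simp add: ZM[symmetric] xi[symmetric] qR qM qZ)
  moreover have "ln (det M) = ln (det R) + ln (det \<Theta>)" using dM dR dT by (simp add: ln_mult)
  ultimately have "\<bar>1/2 * ((ln (det Z) + (mat_norm (mat_inv Z) r)\<^sup>2)
        - (ln (det R) + ln (det \<Theta>) + (mat_norm (mat_inv \<Theta>) e)\<^sup>2))\<bar>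
      \<le> 1/2 * (\<xi> + (\<beta> 1)\<^sup>2 * (\<xi> / (1 + \<xi>)))"
    by (simp add: abs_mult)
  also have "1/2 * ((ln (det Z) + (mat_norm (mat_inv Z) r)\<^sup>2)
        - (ln (det R) + ln (det \<Theta>) + (mat_norm (mat_inv \<Theta>) e)\<^sup>2)) = Fbar - Ftilde"
    by (simp add: assms(11,17) r_def e_def algebra_simps)
  finally show ?thesis .
qed

end
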